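(* There is an absolute constant $C>0$ such that the following holds. Let $A\in\mathbb{R}^{n\times n}$ be a balanceable matrix and let $\epsilon>0$. Let $u_0=\mathbf 0,u_1,u_2,\dots$ be the vectors obtained after $0,1,2,\dots$ cycles of Osborne's algorithm run on $A$. Then there is an integer $t$ with $$0\le t\le C\,\frac{\log\kappa}{\epsilon}\,\min\Big\{\frac1\epsilon,\ d\Big\}$$ such that $\mathbb{D}(e^{u_t})$ $\epsilon$-balances $A$. That is, Osborne's algorithm finds an $\epsilon$-balancing after $O\big(\frac{\log\kappa}{\epsilon}\min\{\frac1\epsilon,d\}\big)$ cycles. This amounts to $O\big(m\,\frac{\log\kappa}{\epsilon}\min\{\frac1\epsilon,d\}\big)$ arithmetic operations.
   Context: Throughout $n\ge 2$ and $A\in\mathbb{R}^{n\times n}$ has nonnegative entries and zero diagonal. $G_A$ is the directed graph on $[n]=\{1,\dots,n\}$ with edge set $\{(i,j):A_{ij}\ne0\}$. $A$ is called balanceable if $G_A$ is strongly connected. Parameters: $m$ is the number of nonzero entries of $A$; $\kappa=\big(\sum_{i,j}A_{ij}\big)/\min_{(i,j):A_{ij}\ne0}A_{ij}$; $d$ is the diameter of $G_A$ (the maximum over ordered pairs $(i,j)$ of the length of a shortest directed path from $i$ to $j$). For $u\in\mathbb{R}^n$ with coordinates $u^{(1)},\dots,u^{(n)}$, $\mathbb{D}(e^{u})$ is the diagonal matrix with diagonal entries $e^{u^{(1)}},\dots,e^{u^{(n)}}$. Let $M(u)=\mathbb{D}(e^u)A\,\mathbb{D}(e^{-u})$, so $M(u)_{ij}=e^{u^{(i)}-u^{(j)}}A_{ij}$;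 let $r_j(u)=\sum_i M(u)_{ji}$ and $c_j(u)=\sum_i M(u)_{ij}$ be its $j$-th row and column sums. $\mathbb{D}(e^u)$ is said to $\epsilon$-balance $A$ (to be an $\epsilon$-balancing) if $\sum_{j=1}^n|r_j(u)-c_j(u)|\le\epsilon\sum_{i,j}M(u)_{ij}$. Osborne's algorithm: set $u_0=\mathbf 0$. For each cycle $k=0,1,2,\dots$: set $u_{k,1}=u_k$; for $j=1,\dots,n$ in this order, let $u_{k,j+1}$ be $u_{k,j}$ with only its $j$-th coordinate changed, the new value being $u_k^{(j)}+\tfrac12\log c_j(u_{k,j})-\tfrac12\log r_j(u_{k,j})$; finally $u_{k+1}=u_{k,n+1}$. Arithmetic operations are counted in the exact real-number model (arithmetic operations and elementary functions $\sqrt{\cdot},\exp,\log$ at unit cost), with $A$ accessed through its nonzero entries. *)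

theory Defs
  imports
    Complex_Main
    "Jordan_Normal_Form.Matrix"
    "Graph_Theory.Digraph_Component"
begin

text \<open>
  Matrices and vectors are those of \<open>Jordan_Normal_Form\<close>, so that the dimension is an ordinary
  natural number and a constant can be chosen before it. The index set is \<open>{0..<n}\<close>.
\<close>

definition support :: "real mat \<Rightarrow> (nat \<times> nat) set" where
  "support A = {(i, j). i < dim_row A \<and> j < dim_col A \<and> A $$ (i, j) \<noteq> 0}"

definition graph_of :: "real mat \<Rightarrow> (nat, nat \<times> nat) pre_digraph" where
  "graph_of A = \<lparr>verts = {..<dim_row A}, arcs = support A, tail = fst, head = snd\<rparr>"

definition balanceable :: "real mat \<Rightarrow> bool" where
  "balanceable A \<longleftrightarrow> strongly_connected (graph_of A)"

definition num_nonzeros :: "real mat \<Rightarrow> nat" where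
  "num_nonzeros A = card (support A)"

definition entry_sum :: "real mat \<Rightarrow> real" where
  "entry_sum A = (\<Sum>i<dim_row A. \<Sum>j<dim_col A. A $$ (i, j))"

definition kappa :: "real mat \<Rightarrow> real" where
  "kappa A = entry_sum A / Min ((\<lambda>ij. A $$ ij) ` support A)"

text \<open>The following two notions are meaningful for finite, strongly connected digraphs only.\<close>

definition distance :: "('v, 'e) pre_digraph \<Rightarrow> 'v \<Rightarrow> 'v \<Rightarrow> nat" where
  "distance G u v = (LEAST l. \<exists>p. pre_digraph.awalk G u p v \<and> length p = l)"

definition diameter :: "('v, 'e) pre_digraph \<Rightarrow> nat" where
  "diameter G = Max ((\<lambda>(u, v). distance G u v) ` (verts G \<times> verts G))"


subsection \<open>Diagonal scaling and approximate balancing\<close>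

definition diag_exp :: "real vec \<Rightarrow> real mat" where
  "diag_exp u = mat_diag (dim_vec u) (\<lambda>i. exp (u $ i))"

definition scaled :: "real mat \<Rightarrow> real vec \<Rightarrow> real mat" where
  "scaled A u = diag_exp u * A * diag_exp (- u)"

definition row_sum :: "real mat \<Rightarrow> nat \<Rightarrow> real" where
  "row_sum M j = (\<Sum>i<dim_col M. M $$ (j, i))"

definition col_sum :: "real mat \<Rightarrow> nat \<Rightarrow> real" where
  "col_sum M j = (\<Sum>i<dim_row M. M $$ (i, j))"

definition eps_balances :: "real \<Rightarrow> real mat \<Rightarrow> real vec \<Rightarrow> bool" where
  "eps_balances \<epsilon> A u \<longleftrightarrow>
     (\<Sum>j<dim_row A. \<bar>row_sum (scaled A u) j - col_sum (scaled A u) j\<bar>)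
       \<le> \<epsilon> * entry_sum (scaled A u)"


subsection \<open>Osborne's algorithm\<close>

text \<open>
  \<open>osborne_partial A u j\<close> is the vector obtained from \<open>u\<close>, the vector at the start of a cycle,
  once the coordinates \<open>0, \<dots>, j - 1\<close> have been updated.
\<close>

fun osborne_partial :: "real mat \<Rightarrow> real vec \<Rightarrow> nat \<Rightarrow> real vec" where
  "osborne_partial A u 0 = u"
| "osborne_partial A u (Suc j) =
     (let v = osborne_partial A u j in
      v |\<^sub>v j \<mapsto> (u $ j + 1/2 * ln (col_sum (scaled A v) j)
                      - 1/2 * ln (row_sum (scaled A v) j)))"

fun osborne :: "real mat \<Rightarrow> nat \<Rightarrow> real vec" where
  "osborne A 0 = 0\<^sub>v (dim_row A)"
| "osborne A (Suc k) = osborne_partial A (osborne A k) (dim_row A)"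


subsection \<open>Arithmetic cost\<close>

text \<open>
  Exact real arithmetic is modelled by straight-line programs whose instructions are single
  arithmetic operations or elementary functions, applied to memory cells or literal constants;
  each instruction has unit cost, so the number of operations is the length of the program.
\<close>

datatype cell = Coord nat | Entry nat nat | RowAcc | ColAcc | Tmp

datatype operand = Cell cell | Lit real

datatype instr =
    Add cell operand operand
  | Sub cell operand operand
  | Mul cell operand operand
  | Div cell operand operand
  | Sqrt cell operand
  | Exp cell operand
  | Log cell operand

type_synonym memory = "cell \<Rightarrow> real"

fun fetch :: "memory \<Rightarrow> operand \<Rightarrow> real" where
  "fetch s (Cell c) = s c"
| "fetch s (Lit x) = x"

fun exec_instr :: "instr \<Rightarrow> memory \<Rightarrow> memory" where
  "exec_instr (Add c x y) s = s(c := fetch s x + fetch s y)"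
| "exec_instr (Sub c x y) s = s(c := fetch s x - fetch s y)"
| "exec_instr (Mul c x y) s = s(c := fetch s x * fetch s y)"
| "exec_instr (Div c x y) s = s(c := fetch s x / fetch s y)"
| "exec_instr (Sqrt c x) s = s(c := sqrt (fetch s x))"
| "exec_instr (Exp c x) s = s(c := exp (fetch s x))"
| "exec_instr (Log c x) s = s(c := ln (fetch s x))"

definition exec :: "instr list \<Rightarrow> memory \<Rightarrow> memory" where
  "exec P = fold exec_instr P"

definition num_ops :: "instr list \<Rightarrow> nat" where
  "num_ops P = length P"

text \<open>
  The program for Osborne's algorithm depends on the matrix only through the sparsity pattern
  \<open>E\<close>, and accesses only the cells of the nonzero entries. Accumulators are reset by adding
  literal zeros, as there is no uncounted assignment.
\<close>

definition add_term :: "cell \<Rightarrow> nat \<Rightarrow> nat \<Rightarrow> instr list" where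
  "add_term acc i j =
     [Sub Tmp (Cell (Coord i)) (Cell (Coord j)),
      Exp Tmp (Cell Tmp),
      Mul Tmp (Cell Tmp) (Cell (Entry i j)),
      Add acc (Cell acc) (Cell Tmp)]"

definition update_program :: "nat \<Rightarrow> (nat \<times> nat) set \<Rightarrow> nat \<Rightarrow> instr list" where
  "update_program n E j =
     [Add ColAcc (Lit 0) (Lit 0)]
     @ concat (map (\<lambda>i. add_term ColAcc i j) (filter (\<lambda>i. (i, j) \<in> E) [0..<n]))
     @ [Add RowAcc (Lit 0) (Lit 0)]
     @ concat (map (\<lambda>i. add_term RowAcc j i) (filter (\<lambda>i. (j, i) \<in> E) [0..<n]))
     @ [Log Tmp (Cell ColAcc),
        Mul Tmp (Lit (1/2)) (Cell Tmp),
        Add (Coord j) (Cell (Coord j)) (Cell Tmp),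
        Log Tmp (Cell RowAcc),
        Mul Tmp (Lit (1/2)) (Cell Tmp),
        Sub (Coord j) (Cell (Coord j)) (Cell Tmp)]"

definition cycle_program :: "nat \<Rightarrow> (nat \<times> nat) set \<Rightarrow> instr list" where
  "cycle_program n E = concat (map (update_program n E) [0..<n])"

definition osborne_program :: "nat \<Rightarrow> (nat \<times> nat) set \<Rightarrow> nat \<Rightarrow> instr list" where
  "osborne_program n E t = concat (replicate t (cycle_program n E))"

text \<open>Initially the memory holds the nonzero entries of the matrix and the zero vector.\<close>

definition initial_memory :: "real mat \<Rightarrow> memory" where
  "initial_memory A c =
     (case c of Entry i j \<Rightarrow> if (i, j) \<in> support A then A $$ (i, j) else 0 | _ \<Rightarrow> 0)"

end

theory Submission
  imports Defs "HOL-Analysis.Convex"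
begin

text \<open>
  Write \<open>M(u)\<close> for the scaled matrix and \<open>F(u)\<close> for the sum of its entries. Updating coordinate \<open>j\<close>
  minimizes \<open>F\<close> exactly in that coordinate: row and column \<open>j\<close> both get the sum \<open>\<surd>(r c)\<close>, and \<open>F\<close>
  drops by \<open>(\<surd>r - \<surd>c)\<^sup>2\<close>, where \<open>r\<close> and \<open>c\<close> are the sums of row and column \<open>j\<close> just before the
  update. The difficulty of the cyclic order is that these \<open>n\<close> drops are seen at \<open>n\<close> different
  matrices, whereas the imbalance is a property of a single one. A cycle changes every off-diagonal
  entry \<open>(i, j)\<close> exactly twice, at the updates of \<open>i\<close> and of \<open>j\<close>, so that it has an initial, an
  intermediate and a final value; everything is accounted for in these three matrices, without any
  loss of a factor \<open>n\<close>:

  \<^item> Right after its update, row and column \<open>j\<close> agree; they are unbalanced by the later updates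
    \<open>k\<close>, and the total change that update \<open>k\<close> makes in the rows and columns that were already
    balanced is at most \<open>\<bar>r - c\<bar>\<close> for \<open>k\<close> itself. So the imbalance at the end of the cycle is at most
    the sum of the \<open>\<bar>r - c\<bar>\<close> met on the way (\<open>imbalance_after_le\<close>).
  \<^item> The sum of all \<open>r + c\<close> met on the way is the initial total plus the intermediate total, and
    the latter is at most twice the initial total plus the final one (\<open>total_mid_le\<close>).
  \<^item> By Cauchy-Schwarz the squared imbalance after a cycle is therefore at most \<open>8 F\<close> times the
    decrease of \<open>F\<close> over that cycle (\<open>imbalance_after_squared_le\<close>). Hence \<open>ln F\<close> decreases by at least
    \<open>e\<^sup>2 / 32\<close>, where \<open>e\<close> is the imbalance after the cycle divided by \<open>F\<close> (\<open>ln_decrease_ge\<close>).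

  Since \<open>F\<close> never falls below the least nonzero entry, \<open>ln F\<close> can decrease by \<open>ln \<kappa>\<close> at most, which
  allows only \<open>32 ln \<kappa> / \<epsilon>\<^sup>2\<close> cycles before some \<open>e\<close> is at most \<open>\<epsilon>\<close>. For the bound with the diameter
  \<open>d\<close>, \<open>ln F\<close> is convex; the coordinates of its gradient add up to zero, and their absolute values
  add up to \<open>e\<close>. Along an edge, two coordinates differ by at most \<open>ln \<kappa>\<close> as long as \<open>F\<close> does not exceed its initial value, so along the
  run any two differ by at most \<open>d ln \<kappa>\<close>, and \<open>ln F\<close> exceeds its value at the end of the run by at
  most \<open>2 d ln \<kappa> e\<close> (\<open>ln_total_diff_le\<close>). An excess \<open>\<Delta>\<close> thus forces a decrease of the order of
  \<open>(\<Delta> / (d ln \<kappa>))\<^sup>2\<close>, and this recurrence together with \<open>e > \<epsilon>\<close> lasts for \<open>O(d ln \<kappa> / \<epsilon>)\<close> cycles only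
  (\<open>descent_steps_le\<close>). Comparing with the last vector of the run instead of with a minimizer avoids
  the question whether one exists.

  A cycle costs eight operations per nonzero entry and eight per coordinate, and strong connectivity
  gives every vertex an outgoing edge, so \<open>n \<le> m\<close>.
\<close>

section \<open>Bookkeeping for one cycle of coordinate updates\<close>

definition entry_total :: "nat \<Rightarrow> (nat \<Rightarrow> nat \<Rightarrow> real) \<Rightarrow> real" where
  "entry_total n a = (\<Sum>i<n. \<Sum>j<n. a i j)"

definition imbalance :: "nat \<Rightarrow> (nat \<Rightarrow> nat \<Rightarrow> real) \<Rightarrow> real" where
  "imbalance n a = (\<Sum>j<n. \<bar>(\<Sum>k<n. a j k) - (\<Sum>k<n. a k j)\<bar>)"

text \<open>
  Coordinates are updated in increasing order. When it is the turn of \<open>j\<close>, an entry of row or column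
  \<open>j\<close> has been touched once more if its other index is below \<open>j\<close>. With \<open>(f, g)\<close> the initial and
  intermediate matrices these are the sums just before the update of \<open>j\<close>; with the intermediate and
  final matrices they are the sums just after it.
\<close>
definition hybrid_row :: "nat \<Rightarrow> (nat \<Rightarrow> nat \<Rightarrow> real) \<Rightarrow> (nat \<Rightarrow> nat \<Rightarrow> real) \<Rightarrow> nat \<Rightarrow> real" where
  "hybrid_row n f g j = (\<Sum>k<n. if k < j then g j k else f j k)"

definition hybrid_col :: "nat \<Rightarrow> (nat \<Rightarrow> nat \<Rightarrow> real) \<Rightarrow> (nat \<Rightarrow> nat \<Rightarrow> real) \<Rightarrow> nat \<Rightarrow> real" where
  "hybrid_col n f g j = (\<Sum>k<n. if k < j then g k j else f k j)"

text \<open>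
  Each off-diagonal position belongs to one row and to one column; one of the two sees the value in
  \<open>f\<close>, namely that of the smaller index, and the other one the value in \<open>g\<close>.
\<close>
lemma sum_hybrid_rows_cols:
  assumes "\<And>j. j < n \<Longrightarrow> f j j = g j j"
  shows "(\<Sum>j<n. hybrid_row n f g j + hybrid_col n f g j) = entry_total n f + entry_total n g"
proof -
  have "(\<Sum>j<n. hybrid_col n f g j) = (\<Sum>j<n. \<Sum>k<n. if j < k then g j k else f j k)"
    unfolding hybrid_col_def by (rule sum.swap)
  then have "(\<Sum>j<n. hybrid_row n f g j + hybrid_col n f g j)
    = (\<Sum>j<n. \<Sum>k<n. (if k < j then g j k else f j k) + (if j < k then g j k else f j k))"
    by (simp add: sum.distrib hybrid_row_def)
  also have "\<dots> = (\<Sum>j<n. \<Sum>k<n. f j k + g j k)"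
    using assms by (intro sum.cong refl) (auto simp: not_less_iff_gr_or_eq)
  finally show ?thesis
    by (simp add: sum.distrib entry_total_def)
qed

lemma total_by_later_index:
  assumes "\<And>j. j < n \<Longrightarrow> f j j = 0"
  shows "(\<Sum>j<n. \<Sum>k<n. if j < k then f j k + f k j else 0) = entry_total n f"
proof -
  have "(\<Sum>j<n. \<Sum>k<n. if j < k then f j k + f k j else 0)
    = (\<Sum>j<n. \<Sum>k<n. if j < k then f j k else 0) + (\<Sum>j<n. \<Sum>k<n. if j < k then f k j else 0)"
    unfolding sum.distrib[symmetric] by (intro sum.cong) auto
  also have "(\<Sum>j<n. \<Sum>k<n. if j < k then f k j else 0) = (\<Sum>j<n. \<Sum>k<n. if k < j then f j k else 0)"
    by (rule sum.swap)
  also have "(\<Sum>j<n. \<Sum>k<n. if j < k then f j k else 0) + \<dots>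
    = (\<Sum>j<n. \<Sum>k<n. (if j < k then f j k else 0) + (if k < j then f j k else 0))"
    by (simp add: sum.distrib)
  also have "\<dots> = entry_total n f"
    unfolding entry_total_def using assms by (intro sum.cong refl) (auto simp: not_less_iff_gr_or_eq)
  finally show ?thesis .
qed

lemma total_by_earlier_index:
  assumes "\<And>j. j < n \<Longrightarrow> f j j = 0"
  shows "(\<Sum>j<n. \<Sum>k<n. if k < j then f j k + f k j else 0) = entry_total n f"
proof -
  have "(\<Sum>j<n. \<Sum>k<n. if k < j then f j k + f k j else 0)
    = (\<Sum>j<n. \<Sum>k<n. if j < k then f j k + f k j else 0)"
    by (subst sum.swap) (simp add: add.commute cong: if_cong)
  then show ?thesis
    using total_by_later_index[of n f] assms by simp
qed

text \<open>
  One cycle, with \<open>a\<close> the matrix at its start and \<open>\<delta> j\<close> the increment of coordinate \<open>j\<close>: entry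
  \<open>(i, j)\<close> is multiplied by \<open>exp (\<delta> i)\<close> and by \<open>exp (- \<delta> j)\<close>, and \<open>mid\<close> is the matrix of the entries
  after the first of these two factors. That row and column \<open>j\<close> agree after their update is all that
  is assumed about \<open>\<delta>\<close>.
\<close>
locale sweep =
  fixes n :: nat and a :: "nat \<Rightarrow> nat \<Rightarrow> real" and \<delta> :: "nat \<Rightarrow> real"
  fixes mid fin :: "nat \<Rightarrow> nat \<Rightarrow> real"
  defines "mid \<equiv> \<lambda>i j. exp (if i < j then \<delta> i else - \<delta> j) * a i j"
      and "fin \<equiv> \<lambda>i j. exp (\<delta> i - \<delta> j) * a i j"
  assumes nonneg: "i < n \<Longrightarrow> j < n \<Longrightarrow> a i j \<ge> 0"
      and zero_diag: "i < n \<Longrightarrow> a i i = 0"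
      and balance: "j < n \<Longrightarrow>
        exp (\<delta> j) * hybrid_row n a mid j = exp (- \<delta> j) * hybrid_col n a mid j"
begin

lemma mid_nonneg: "i < n \<Longrightarrow> j < n \<Longrightarrow> mid i j \<ge> 0"
  and fin_nonneg: "i < n \<Longrightarrow> j < n \<Longrightarrow> fin i j \<ge> 0"
  and mid_diag: "i < n \<Longrightarrow> mid i i = 0"
  and fin_diag: "i < n \<Longrightarrow> fin i i = 0"
  using nonneg zero_diag by (auto simp: mid_def fin_def)

lemma row_after: "j < n \<Longrightarrow> hybrid_row n mid fin j = exp (\<delta> j) * hybrid_row n a mid j"
  unfolding hybrid_row_def sum_distrib_left
  by (intro sum.cong refl)
     (auto simp: mid_def fin_def zero_diag not_less_iff_gr_or_eq exp_diff exp_minus field_simps)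

lemma col_after: "j < n \<Longrightarrow> hybrid_col n mid fin j = exp (- \<delta> j) * hybrid_col n a mid j"
  unfolding hybrid_col_def sum_distrib_left
  by (intro sum.cong refl)
     (auto simp: mid_def fin_def zero_diag not_less_iff_gr_or_eq exp_diff exp_minus field_simps)

lemma col_before:
  assumes "j < n"
  shows "hybrid_col n a mid j = (exp (\<delta> j))\<^sup>2 * hybrid_row n a mid j"
  using balance[OF assms] by (simp add: exp_minus field_simps power2_eq_square)

lemma row_before_nonneg: "j < n \<Longrightarrow> hybrid_row n a mid j \<ge> 0"
  unfolding hybrid_row_def by (intro sum_nonneg) (auto simp: mid_nonneg nonneg)

text \<open>
  The sums just after the update of \<open>j\<close> and those just before it add up over \<open>j\<close> to \<open>mid + fin\<close> and to
  \<open>a + mid\<close>, so the intermediate total cancels in the difference.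
\<close>
lemma decrease:
  "entry_total n a - entry_total n fin = (\<Sum>j<n. hybrid_row n a mid j * (exp (\<delta> j) - 1)\<^sup>2)"
proof -
  have "entry_total n a - entry_total n fin = (\<Sum>j<n. hybrid_row n a mid j + hybrid_col n a mid j)
      - (\<Sum>j<n. hybrid_row n mid fin j + hybrid_col n mid fin j)"
    using sum_hybrid_rows_cols[of n a mid] sum_hybrid_rows_cols[of n mid fin]
    by (simp add: zero_diag mid_diag fin_diag)
  also have "\<dots> = (\<Sum>j<n. hybrid_row n a mid j * (exp (\<delta> j) - 1)\<^sup>2)"
    unfolding sum_subtractf[symmetric]
  proof (intro sum.cong refl)
    fix j assume "j \<in> {..<n}"
    then have j: "j < n" by simp
    show "hybrid_row n a mid j + hybrid_col n a mid j
        - (hybrid_row n mid fin j + hybrid_col n mid fin j)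
      = hybrid_row n a mid j * (exp (\<delta> j) - 1)\<^sup>2"
      unfolding row_after[OF j] col_after[OF j] balance[OF j, symmetric] col_before[OF j]
      by (simp add: exp_minus power2_eq_square algebra_simps)
  qed
  finally show ?thesis .
qed

text \<open>
  Of the two factors \<open>exp (\<delta> j)\<close> and \<open>exp (- \<delta> j)\<close> one is at most 1. Hence the update of \<open>j\<close> enlarges
  only one of the row and the column part that are still to be touched; that part is bounded by the
  whole opposite side, because row and column \<open>j\<close> agree after the update. The intermediate mass that
  update \<open>j\<close> creates is therefore paid for by initial mass and by mass that stays for good.
\<close>
lemma mid_leaving_le:
  assumes j: "j < n"
  shows "(\<Sum>k<n. if j < k then mid j k + mid k j else 0)
    \<le> 2 * (\<Sum>k<n. if j < k then a j k + a k j else 0)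
      + (\<Sum>k<n. if k < j then fin j k + fin k j else 0)"
proof -
  define later where "later f = (\<Sum>k<n. if j < k then f k else 0)" for f :: "nat \<Rightarrow> real"
  define earlier where "earlier f = (\<Sum>k<n. if k < j then f k else 0)" for f :: "nat \<Rightarrow> real"
  have later_add: "(\<Sum>k<n. if j < k then f k + g k else 0) = later f + later g"
    and earlier_add: "(\<Sum>k<n. if k < j then f k + g k else 0) = earlier f + earlier g" for f g
    unfolding later_def earlier_def by (auto simp flip: sum.distrib intro!: sum.cong)
  have after: "hybrid_row n mid fin j = earlier (fin j) + later (mid j)"
    "hybrid_col n mid fin j = earlier (\<lambda>k. fin k j) + later (\<lambda>k. mid k j)"
    unfolding later_def earlier_def hybrid_row_def hybrid_col_def sum.distrib[symmetric]
    using mid_diag j by (auto intro!: sum.cong simp: not_less_iff_gr_or_eq)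
  have bal: "earlier (fin j) + later (mid j) = earlier (\<lambda>k. fin k j) + later (\<lambda>k. mid k j)"
    using balance[OF j] row_after[OF j] col_after[OF j] after by simp
  have row: "later (mid j) = exp (\<delta> j) * later (a j)"
    and col: "later (\<lambda>k. mid k j) = exp (- \<delta> j) * later (\<lambda>k. a k j)"
    unfolding later_def sum_distrib_left by (auto intro!: sum.cong simp: mid_def)
  have nn: "later (a j) \<ge> 0" "later (\<lambda>k. a k j) \<ge> 0"
     "earlier (fin j) \<ge> 0" "earlier (\<lambda>k. fin k j) \<ge> 0"
    unfolding later_def earlier_def using j by (auto intro!: sum_nonneg nonneg fin_nonneg)
  have "later (mid j) + later (\<lambda>k. mid k j)
    \<le> 2 * (later (a j) + later (\<lambda>k. a k j)) + (earlier (fin j) + earlier (\<lambda>k. fin k j))"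
  proof (cases "\<delta> j \<ge> 0")
    case True
    then have "later (\<lambda>k. mid k j) \<le> later (\<lambda>k. a k j)"
      unfolding col using nn by (simp add: mult_left_le_one_le)
    then show ?thesis using bal nn by smt
  next
    case False
    then have "later (mid j) \<le> later (a j)"
      unfolding row using nn by (simp add: mult_left_le_one_le)
    then show ?thesis using bal nn by smt
  qed
  then show ?thesis by (simp add: later_add earlier_add)
qed

lemma total_mid_le: "entry_total n mid \<le> 2 * entry_total n a + entry_total n fin"
proof -
  have "entry_total n mid = (\<Sum>j<n. \<Sum>k<n. if j < k then mid j k + mid k j else 0)"
    by (simp add: total_by_later_index mid_diag)
  also have "\<dots> \<le> (\<Sum>j<n. 2 * (\<Sum>k<n. if j < k then a j k + a k j else 0)
      + (\<Sum>k<n. if k < j then fin j k + fin k j else 0))"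
    by (intro sum_mono mid_leaving_le) simp
  also have "\<dots> = 2 * entry_total n a + entry_total n fin"
    by (simp add: sum.distrib sum_distrib_left[symmetric] total_by_later_index
        total_by_earlier_index zero_diag fin_diag)
  finally show ?thesis .
qed

text \<open>
  The update of \<open>k\<close> moves the sums of row and column \<open>k\<close>, \<open>r\<close> and \<open>c\<close>, to their geometric mean, which
  lies between them. All entries of the row move in one direction and all entries of the column in
  the other one, so the absolute changes add up to \<open>\<bar>r - c\<bar>\<close> exactly; only those at already updated
  indices are counted on the left.
\<close>
lemma change_le_imbalance_before:
  assumes k: "k < n"
  shows "(\<Sum>j<n. if j < k then \<bar>fin j k - mid j k\<bar> + \<bar>fin k j - mid k j\<bar> else 0)
    \<le> \<bar>hybrid_row n a mid k - hybrid_col n a mid k\<bar>"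
proof -
  let ?e = "exp (\<delta> k)" and ?r = "hybrid_row n a mid k" and ?c = "hybrid_col n a mid k"
  have fin_col: "\<bar>fin j k - mid j k\<bar> = \<bar>exp (- \<delta> k) - 1\<bar> * mid j k"
    and fin_row: "\<bar>fin k j - mid k j\<bar> = \<bar>?e - 1\<bar> * mid k j" if "j < k" for j
  proof -
    have "fin j k - mid j k = (exp (- \<delta> k) - 1) * mid j k" "fin k j - mid k j = (?e - 1) * mid k j"
      using that by (auto simp: fin_def mid_def exp_diff exp_minus field_simps)
    then show "\<bar>fin j k - mid j k\<bar> = \<bar>exp (- \<delta> k) - 1\<bar> * mid j k"
      "\<bar>fin k j - mid k j\<bar> = \<bar>?e - 1\<bar> * mid k j"
      using mid_nonneg[of j k] mid_nonneg[of k j] that k by (simp_all add: abs_mult)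
  qed
  have "(\<Sum>j<n. if j < k then \<bar>fin j k - mid j k\<bar> + \<bar>fin k j - mid k j\<bar> else 0)
    \<le> (\<Sum>j<n. \<bar>exp (- \<delta> k) - 1\<bar> * (if j < k then mid j k else a j k)
         + \<bar>?e - 1\<bar> * (if j < k then mid k j else a k j))"
    using k by (intro sum_mono) (auto simp: fin_col fin_row nonneg)
  also have "\<dots> = \<bar>exp (- \<delta> k) - 1\<bar> * ?c + \<bar>?e - 1\<bar> * ?r"
    by (simp add: sum.distrib sum_distrib_left hybrid_row_def hybrid_col_def)
  also have "\<dots> = \<bar>?r - ?c\<bar>"
  proof -
    have r: "?r \<ge> 0" by (rule row_before_nonneg[OF k])
    have c: "?c = ?e\<^sup>2 * ?r" by (rule col_before[OF k])
    have "exp (- \<delta> k) - 1 = (1 - ?e) / ?e" by (simp add: exp_minus field_simps)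
    then have "\<bar>exp (- \<delta> k) - 1\<bar> = \<bar>?e - 1\<bar> / ?e" by (simp add: abs_divide)
    then have "\<bar>exp (- \<delta> k) - 1\<bar> * ?c = \<bar>?e - 1\<bar> * ?e * ?r"
      by (simp add: c power2_eq_square)
    then have "\<bar>exp (- \<delta> k) - 1\<bar> * ?c + \<bar>?e - 1\<bar> * ?r = \<bar>?e - 1\<bar> * (?e + 1) * ?r"
      by (simp add: algebra_simps)
    also have "\<dots> = \<bar>(?e - 1) * (?e + 1) * ?r\<bar>"
      using r by (simp add: abs_mult)
    also have "(?e - 1) * (?e + 1) * ?r = - (?r - ?c)"
      by (simp add: c power2_eq_square algebra_simps)
    finally show ?thesis by simp
  qed
  finally show ?thesis .
qed

text \<open>
  Row and column \<open>j\<close> agree just after their update, where entry \<open>(j, k)\<close> is final for \<open>k < j\<close> and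
  intermediate for \<open>k > j\<close>. Their final difference is thus a sum of changes from \<open>mid\<close> to \<open>fin\<close> made
  by the later updates, and these changes are collected by the update that makes them.
\<close>
lemma imbalance_after_le:
  "imbalance n fin \<le> (\<Sum>j<n. \<bar>hybrid_row n a mid j - hybrid_col n a mid j\<bar>)"
proof -
  have "imbalance n fin
    \<le> (\<Sum>j<n. \<Sum>k<n. if j < k then \<bar>fin j k - mid j k\<bar> + \<bar>fin k j - mid k j\<bar> else 0)"
    unfolding imbalance_def
  proof (intro sum_mono)
    fix j assume "j \<in> {..<n}"
    then have j: "j < n" by simp
    have "hybrid_row n mid fin j = hybrid_col n mid fin j"
      by (simp add: row_after col_after balance j)
    then have "(\<Sum>k<n. fin j k) - (\<Sum>k<n. fin k j)
      = ((\<Sum>k<n. fin j k) - hybrid_row n mid fin j) - ((\<Sum>k<n. fin k j) - hybrid_col n mid fin j)"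
      by simp
    also have "\<dots> = (\<Sum>k<n. if j < k then (fin j k - mid j k) - (fin k j - mid k j) else 0)"
      unfolding hybrid_row_def hybrid_col_def sum_subtractf[symmetric]
      using j fin_diag mid_diag by (auto intro!: sum.cong simp: not_less_iff_gr_or_eq)
    also have "\<bar>\<dots>\<bar> \<le> (\<Sum>k<n. \<bar>if j < k then (fin j k - mid j k) - (fin k j - mid k j) else 0\<bar>)"
      by (rule sum_abs)
    also have "\<dots> \<le> (\<Sum>k<n. if j < k then \<bar>fin j k - mid j k\<bar> + \<bar>fin k j - mid k j\<bar> else 0)"
      by (intro sum_mono) (simp add: abs_triangle_ineq4)
    finally show "\<bar>(\<Sum>k<n. fin j k) - (\<Sum>k<n. fin k j)\<bar>
      \<le> (\<Sum>k<n. if j < k then \<bar>fin j k - mid j k\<bar> + \<bar>fin k j - mid k j\<bar> else 0)" .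
  qed
  also have "\<dots> = (\<Sum>k<n. \<Sum>j<n. if j < k then \<bar>fin j k - mid j k\<bar> + \<bar>fin k j - mid k j\<bar> else 0)"
    by (rule sum.swap)
  also have "\<dots> \<le> (\<Sum>k<n. \<bar>hybrid_row n a mid k - hybrid_col n a mid k\<bar>)"
    by (intro sum_mono change_le_imbalance_before) simp
  finally show ?thesis .
qed

text \<open>
  With \<open>q = exp (\<delta> j)\<close> one has \<open>c = q\<^sup>2 r\<close>, hence \<open>\<bar>r - c\<bar> = (\<surd>r \<bar>q - 1\<bar>) (\<surd>r (q + 1))\<close>. In the
  Cauchy-Schwarz inequality the squares of the first factors add up to the decrease of the total, and
  those of the second ones are at most \<open>2 (r + c)\<close>.
\<close>
lemma imbalance_after_squared_le:
  "(imbalance n fin)\<^sup>2 \<le> 8 * entry_total n a * (entry_total n a - entry_total n fin)"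
proof -
  let ?r = "hybrid_row n a mid" and ?c = "hybrid_col n a mid" and ?e = "\<lambda>j. exp (\<delta> j)"
  have nonneg_imb: "imbalance n fin \<ge> 0"
    by (simp add: imbalance_def sum_nonneg)
  have total_decrease: "entry_total n a - entry_total n fin \<ge> 0"
    unfolding decrease by (intro sum_nonneg mult_nonneg_nonneg row_before_nonneg) auto
  have "(\<Sum>j<n. \<bar>?r j - ?c j\<bar>)
    = (\<Sum>j<n. (sqrt (?r j) * \<bar>?e j - 1\<bar>) * (sqrt (?r j) * (?e j + 1)))"
  proof (intro sum.cong refl)
    fix j assume "j \<in> {..<n}"
    then have j: "j < n" by simp
    have "?r j - ?c j = - (?r j * ((?e j - 1) * (?e j + 1)))"
      by (simp add: col_before[OF j] power2_eq_square algebra_simps)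
    then have "\<bar>?r j - ?c j\<bar> = ?r j * (\<bar>?e j - 1\<bar> * (?e j + 1))"
      using row_before_nonneg[OF j] by (simp add: abs_mult)
    also have "\<dots> = (sqrt (?r j) * sqrt (?r j)) * (\<bar>?e j - 1\<bar> * (?e j + 1))"
      using row_before_nonneg[OF j] by simp
    finally show "\<bar>?r j - ?c j\<bar> = (sqrt (?r j) * \<bar>?e j - 1\<bar>) * (sqrt (?r j) * (?e j + 1))"
      by (simp only: mult_ac)
  qed
  then have "(imbalance n fin)\<^sup>2
    \<le> (\<Sum>j<n. (sqrt (?r j) * \<bar>?e j - 1\<bar>) * (sqrt (?r j) * (?e j + 1)))\<^sup>2"
    using imbalance_after_le nonneg_imb by (intro power_mono) auto
  also have "\<dots> \<le> (\<Sum>j<n. (sqrt (?r j) * \<bar>?e j - 1\<bar>)\<^sup>2) * (\<Sum>j<n. (sqrt (?r j) * (?e j + 1))\<^sup>2)"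
    by (rule Cauchy_Schwarz_ineq_sum)
  also have "(\<Sum>j<n. (sqrt (?r j) * \<bar>?e j - 1\<bar>)\<^sup>2) = entry_total n a - entry_total n fin"
    unfolding decrease by (intro sum.cong refl) (auto simp: power_mult_distrib row_before_nonneg)
  also have "(\<Sum>j<n. (sqrt (?r j) * (?e j + 1))\<^sup>2) \<le> (\<Sum>j<n. 2 * (?r j + ?c j))"
  proof (intro sum_mono)
    fix j assume "j \<in> {..<n}"
    then have j: "j < n" by simp
    have "2 * (?r j + ?c j) - (sqrt (?r j) * (?e j + 1))\<^sup>2 = ?r j * (?e j - 1)\<^sup>2"
      using row_before_nonneg[OF j]
      by (simp add: col_before[OF j] power_mult_distrib) (simp add: power2_eq_square algebra_simps)
    then show "(sqrt (?r j) * (?e j + 1))\<^sup>2 \<le> 2 * (?r j + ?c j)"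
      using row_before_nonneg[OF j] by (smt (verit) mult_nonneg_nonneg zero_le_power2)
  qed
  also have "(\<Sum>j<n. 2 * (?r j + ?c j)) = 2 * (entry_total n a + entry_total n mid)"
    unfolding sum_distrib_left[symmetric]
    by (simp add: sum_hybrid_rows_cols zero_diag mid_diag)
  also have "\<dots> \<le> 8 * entry_total n a"
    using total_mid_le total_decrease by simp
  finally show ?thesis
    using mult_left_mono[OF _ total_decrease] by (metis mult.commute)
qed

end

section \<open>Convexity of the logarithm of the total\<close>

definition rescaled :: "(nat \<Rightarrow> nat \<Rightarrow> real) \<Rightarrow> (nat \<Rightarrow> real) \<Rightarrow> nat \<Rightarrow> nat \<Rightarrow> real" where
  "rescaled a u i j = exp (u i - u j) * a i j"

lemma rescaled_le_total:
  assumes "\<And>i j. i < n \<Longrightarrow> j < n \<Longrightarrow> a i j \<ge> 0" "i < n" "j < n"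
  shows "rescaled a u i j \<le> entry_total n (rescaled a u)"
proof -
  have "rescaled a u i j \<le> (\<Sum>j<n. rescaled a u i j)"
    using assms by (intro member_le_sum) (auto simp: rescaled_def)
  also have "\<dots> \<le> entry_total n (rescaled a u)"
    unfolding entry_total_def
    using assms by (intro member_le_sum[where f = "\<lambda>i. \<Sum>j<n. rescaled a u i j"] sum_nonneg)
      (auto simp: rescaled_def)
  finally show ?thesis .
qed

lemma imbalance_le_twice_total:
  assumes "\<And>i j. i < n \<Longrightarrow> j < n \<Longrightarrow> a i j \<ge> 0"
  shows "imbalance n a \<le> 2 * entry_total n a"
proof -
  have "imbalance n a \<le> (\<Sum>j<n. (\<Sum>k<n. a j k) + (\<Sum>k<n. a k j))"
    unfolding imbalance_def
  proof (intro sum_mono)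
    fix j assume "j \<in> {..<n}"
    then have "(\<Sum>k<n. a j k) \<ge> 0" "(\<Sum>k<n. a k j) \<ge> 0"
      using assms by (auto intro!: sum_nonneg)
    then show "\<bar>(\<Sum>k<n. a j k) - (\<Sum>k<n. a k j)\<bar> \<le> (\<Sum>k<n. a j k) + (\<Sum>k<n. a k j)"
      by linarith
  qed
  also have "\<dots> = 2 * entry_total n a"
    using sum.swap[of "\<lambda>j k. a k j" "{..<n}" "{..<n}"]
    by (simp add: sum.distrib entry_total_def)
  finally show ?thesis .
qed

text \<open>
  First-order convexity of \<open>ln F\<close>: its gradient at \<open>u\<close> is the vector of the row sums minus the column
  sums, divided by \<open>F(u)\<close>. The coordinates of the gradient add up to zero, so only the distance of
  \<open>v - u\<close> from a vector with equal coordinates \<open>s\<close> matters.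
\<close>
lemma ln_total_diff_le:
  assumes nonneg: "\<And>i j. i < n \<Longrightarrow> j < n \<Longrightarrow> a i j \<ge> 0"
    and pos: "entry_total n (rescaled a u) > 0" "entry_total n (rescaled a v) > 0"
    and close: "\<And>i. i < n \<Longrightarrow> \<bar>(v i - u i) - s\<bar> \<le> D"
  shows "ln (entry_total n (rescaled a u)) - ln (entry_total n (rescaled a v))
    \<le> D * (imbalance n (rescaled a u) / entry_total n (rescaled a u))"
proof -
  define F where "F = entry_total n (rescaled a u)"
  define w where "w i = (v i - u i) - s" for i
  define S where "S = (\<Sum>i<n. \<Sum>j<n. rescaled a u i j * (w i - w j))"
  \<comment> \<open>the weighted mean of \<open>w i - w j\<close>; bounding each exponential from below by its tangent at \<open>\<mu>\<close>
    is the proof of Jensen's inequality\<close>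
  define \<mu> where "\<mu> = S / F"
  have F: "F > 0" using pos by (simp add: F_def)
  have S: "S = (\<Sum>j<n. w j * ((\<Sum>k<n. rescaled a u j k) - (\<Sum>k<n. rescaled a u k j)))"
  proof -
    have "S = (\<Sum>i<n. \<Sum>j<n. rescaled a u i j * w i) - (\<Sum>i<n. \<Sum>j<n. rescaled a u i j * w j)"
      unfolding S_def by (simp add: right_diff_distrib sum_subtractf)
    also have "(\<Sum>i<n. \<Sum>j<n. rescaled a u i j * w j) = (\<Sum>j<n. \<Sum>i<n. rescaled a u i j * w j)"
      by (rule sum.swap)
    finally show ?thesis
      by (simp add: sum_distrib_left right_diff_distrib sum_subtractf mult.commute)
  qed
  have "- S \<le> \<bar>S\<bar>" by simp
  also have "\<dots> \<le> (\<Sum>j<n. \<bar>w j * ((\<Sum>k<n. rescaled a u j k) - (\<Sum>k<n. rescaled a u k j))\<bar>)"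
    unfolding S by (rule sum_abs)
  also have "\<dots> \<le> (\<Sum>j<n. D * \<bar>(\<Sum>k<n. rescaled a u j k) - (\<Sum>k<n. rescaled a u k j)\<bar>)"
    using close by (intro sum_mono) (auto simp: abs_mult w_def intro!: mult_right_mono)
  also have "\<dots> = D * imbalance n (rescaled a u)"
    by (simp add: imbalance_def sum_distrib_left)
  finally have "- \<mu> \<le> D * imbalance n (rescaled a u) / F"
    using F divide_right_mono[of "- S" "D * imbalance n (rescaled a u)" F] by (simp add: \<mu>_def)
  moreover have "exp \<mu> * F \<le> entry_total n (rescaled a v)"
  proof -
    have "(\<Sum>i<n. \<Sum>j<n. rescaled a u i j * (1 + (w i - w j) - \<mu>)) = F + S - \<mu> * F"
      by (simp add: F_def entry_total_def S_def sum.distrib sum_subtractf sum_distrib_left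
          algebra_simps)
    also have "\<dots> = F" using F by (simp add: \<mu>_def)
    finally have "exp \<mu> * F
      = (\<Sum>i<n. \<Sum>j<n. exp \<mu> * (rescaled a u i j * (1 + (w i - w j) - \<mu>)))"
      by (simp only: sum_distrib_left[symmetric])
    also have "\<dots> \<le> entry_total n (rescaled a v)"
      unfolding entry_total_def
    proof (intro sum_mono)
      fix i j assume ij: "i \<in> {..<n}" "j \<in> {..<n}"
      have "exp \<mu> * (rescaled a u i j * (1 + (w i - w j) - \<mu>))
        = (exp \<mu> * rescaled a u i j) * (1 + ((w i - w j) - \<mu>))"
        by (simp add: algebra_simps)
      also have "\<dots> \<le> (exp \<mu> * rescaled a u i j) * exp ((w i - w j) - \<mu>)"
        using ij nonneg by (intro mult_left_mono exp_ge_add_one_self) (auto simp: rescaled_def)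
      also have "\<dots> = (exp \<mu> * exp ((u i - u j)) * exp ((w i - w j) - \<mu>)) * a i j"
        by (simp add: rescaled_def)
      also have "exp \<mu> * exp ((u i - u j)) * exp ((w i - w j) - \<mu>) = exp (v i - v j)"
        by (simp add: w_def flip: exp_add)
      finally show "exp \<mu> * (rescaled a u i j * (1 + (w i - w j) - \<mu>)) \<le> rescaled a v i j"
        by (simp add: rescaled_def)
    qed
    finally show ?thesis .
  qed
  then have "ln (exp \<mu> * F) \<le> ln (entry_total n (rescaled a v))"
    using F pos by (subst ln_le_cancel_iff) auto
  then have "\<mu> + ln F \<le> ln (entry_total n (rescaled a v))"
    using F by (simp add: ln_mult)
  ultimately show ?thesis
    by (simp add: F_def)
qed

text \<open>
  If \<open>F\<close> at most halves then \<open>F\<close> and \<open>F'\<close> are interchangeable up to constants. Otherwise \<open>ln F\<close>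
  drops by at least \<open>1 / 2\<close>, which beats \<open>(E / F')\<^sup>2 / 32\<close> as the relative imbalance is at most 2.
\<close>
lemma ln_decrease_ge:
  fixes F F' E :: real
  assumes F': "0 < F'" and le: "F' \<le> F" and E: "0 \<le> E" "E \<le> 2 * F'"
    and main: "E\<^sup>2 \<le> 8 * F * (F - F')"
  shows "(E / F')\<^sup>2 / 32 \<le> ln F - ln F'"
proof -
  have F: "F > 0" using F' le by linarith
  have "ln (F' / F) \<le> F' / F - 1" using F F' by (intro ln_le_minus_one) simp
  then have ln: "1 - F' / F \<le> ln F - ln F'" using F F' by (simp add: ln_div)
  show ?thesis
  proof (cases "F \<le> 2 * F'")
    case True
    have "F' / F \<le> 1" using F le by simp
    have "(E / F')\<^sup>2 \<le> 8 * F * (F - F') / F'\<^sup>2"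
      using main by (simp add: power_divide divide_right_mono)
    also have "\<dots> = 8 * (F / F')\<^sup>2 * (1 - F' / F)"
      using F F' by (simp add: field_simps power2_eq_square)
    also have "\<dots> \<le> 8 * 2\<^sup>2 * (1 - F' / F)"
      using F F' True \<open>F' / F \<le> 1\<close>
      by (intro mult_right_mono mult_left_mono power_mono) (auto simp: field_simps)
    finally show ?thesis using ln by simp
  next
    case False
    have "(E / F')\<^sup>2 \<le> 2\<^sup>2"
      using E F' by (intro power_mono) (auto simp: field_simps)
    moreover have "1 - F' / F \<ge> 1 / 2"
      using False F by (simp add: field_simps)
    ultimately show ?thesis using ln by simp
  qed
qed

text \<open>
  The first bound divides the available decrease \<open>K\<close> by the least decrease per step. For the second
  one, set \<open>x k = L k - L T + \<epsilon> R\<close>. Both summands of \<open>x (k + 1)\<close> are at most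
  \<open>R e (k + 1)\<close>, so \<open>x k - x (k + 1) \<ge> x (k + 1)\<^sup>2 / (128 R\<^sup>2)\<close>, which makes \<open>1 / x\<close> grow by a constant multiple of \<open>1 / R\<^sup>2\<close>
  per step, while it ends at \<open>1 / (\<epsilon> R)\<close>. Adding \<open>\<epsilon> R\<close> merges the phase where the gap \<open>L k - L T\<close>
  dominates with the one where \<open>\<epsilon>\<close> does.
\<close>
lemma descent_steps_le:
  fixes L e :: "nat \<Rightarrow> real"
  assumes eps: "0 < \<epsilon>" "\<epsilon> \<le> 2"
    and K: "0 < K" "K \<le> R" "1 / 2 \<le> R"
    and gap: "L 0 - L T \<le> K"
    and step: "\<And>k. k < T \<Longrightarrow> L k - L (Suc k) \<ge> (e (Suc k))\<^sup>2 / 32"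
    and large: "\<And>k. 0 < k \<Longrightarrow> k \<le> T \<Longrightarrow> e k > \<epsilon>"
    and convex: "\<And>k. k \<le> T \<Longrightarrow> L k - L T \<le> R * e k"
  shows "real T \<le> 32 * K / \<epsilon>\<^sup>2" "real T \<le> 256 * R / \<epsilon>"
proof -
  have eps_step: "\<epsilon>\<^sup>2 / 32 \<le> L k - L (Suc k)" if "k < T" for k
  proof -
    have "\<epsilon>\<^sup>2 \<le> (e (Suc k))\<^sup>2"
      using large[of "Suc k"] that eps by (intro power_mono) auto
    then show ?thesis using step[OF that] by linarith
  qed
  have "L 0 - L k \<ge> real k * (\<epsilon>\<^sup>2 / 32)" if "k \<le> T" for k
    using that
  proof (induction k)
    case (Suc k)
    then show ?case using eps_step[of k] by (simp add: field_simps)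
  qed simp
  then have "real T * (\<epsilon>\<^sup>2 / 32) \<le> K" using gap by force
  then show "real T \<le> 32 * K / \<epsilon>\<^sup>2" using eps by (simp add: field_simps)

  have decr: "L (Suc k) \<le> L k" if "k < T" for k
    using eps_step[OF that] by (smt (verit) zero_le_power2 divide_nonneg_nonneg)
  have anti: "L k \<le> L j" if "j \<le> k" "k \<le> T" for j k
    using that
  proof (induction k rule: dec_induct)
    case (step m)
    then show ?case using decr[of m] by simp
  qed simp
  have R: "R > 0" using K by simp
  define x where "x k = L k - L T + \<epsilon> * R" for k
  have x_pos: "x k > 0" if "k \<le> T" for k
    using anti[of k T] that eps R by (simp add: x_def add_nonneg_pos)
  have x_le: "x k \<le> 3 * R" if "k \<le> T" for k
  proof -
    have "\<epsilon> * R \<le> 2 * R" using eps R by (intro mult_right_mono) auto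
    moreover have "L k \<le> L 0" using anti[of 0 k] that by simp
    ultimately show ?thesis using gap K unfolding x_def by linarith
  qed
  have x_step: "x k - x (Suc k) \<ge> (x (Suc k))\<^sup>2 / (128 * R\<^sup>2)" if "k < T" for k
  proof -
    have "R * \<epsilon> \<le> R * e (Suc k)"
      using large[of "Suc k"] that R by (intro mult_left_mono) auto
    then have "x (Suc k) \<le> 2 * R * e (Suc k)"
      using convex[of "Suc k"] that by (simp add: x_def algebra_simps)
    then have "(x (Suc k))\<^sup>2 \<le> (2 * R * e (Suc k))\<^sup>2"
      using x_pos[of "Suc k"] that by (intro power_mono) auto
    then have "(x (Suc k))\<^sup>2 / (128 * R\<^sup>2) \<le> (e (Suc k))\<^sup>2 / 32"
      using R by (simp add: field_simps)
    then show ?thesis using step[OF that] by (simp add: x_def)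
  qed
  have recip: "1 / x (Suc k) - 1 / x k \<ge> 1 / (256 * R\<^sup>2)" if k: "k < T" for k
  proof -
    have pos: "x k > 0" "x (Suc k) > 0" using x_pos k by auto
    have eq: "1 / x (Suc k) - 1 / x k = (x k - x (Suc k)) / (x k * x (Suc k))"
      using pos by (simp add: field_simps)
    show ?thesis
    proof (cases "x k \<le> 2 * x (Suc k)")
      case True
      have "1 / (256 * R\<^sup>2) \<le> x (Suc k) / x k / (128 * R\<^sup>2)"
        using True pos R by (simp add: field_simps)
      also have "\<dots> = (x (Suc k))\<^sup>2 / (128 * R\<^sup>2) / (x k * x (Suc k))"
        using pos R by (simp add: field_simps power2_eq_square)
      also have "\<dots> \<le> (x k - x (Suc k)) / (x k * x (Suc k))"
        using x_step[OF k] pos by (intro divide_right_mono) auto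
      finally show ?thesis by (simp add: eq)
    next
      case False
      \<comment> \<open>if \<open>x\<close> more than halves, \<open>1 / x\<close> grows by at least \<open>1 / (2 x (k + 1)) \<ge> 1 / (6 R)\<close>,
        and \<open>R \<ge> 1 / 2\<close> makes this large enough\<close>
      have "1 / (256 * R\<^sup>2) \<le> 1 / (6 * R)"
        using K R by (simp add: field_simps power2_eq_square)
      also have "\<dots> \<le> 1 / (2 * x (Suc k))"
        using x_le[of "Suc k"] k pos by (intro divide_left_mono) auto
      also have "\<dots> = (x k / 2) / (x k * x (Suc k))" using pos by (simp add: field_simps)
      also have "\<dots> \<le> (x k - x (Suc k)) / (x k * x (Suc k))"
        using False pos by (intro divide_right_mono) auto
      finally show ?thesis by (simp add: eq)
    qed
  qed
  have "1 / x k \<ge> real k / (256 * R\<^sup>2)" if "k \<le> T" for k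
    using that
  proof (induction k)
    case 0
    then show ?case using x_pos[of 0] by simp
  next
    case (Suc k)
    then show ?case using recip[of k] by (simp add: add_divide_distrib)
  qed
  from this[of T] have "real T / (256 * R\<^sup>2) \<le> 1 / (\<epsilon> * R)" by (simp add: x_def)
  then show "real T \<le> 256 * R / \<epsilon>"
    using eps R by (simp add: field_simps power2_eq_square)
qed

section \<open>Balanceable matrices and the vectors of Osborne's algorithm\<close>

locale balanceable_matrix =
  fixes n :: nat and A :: "real mat"
  assumes n_ge_2: "n \<ge> 2"
    and carrier: "A \<in> carrier_mat n n"
    and nonneg: "i < n \<Longrightarrow> j < n \<Longrightarrow> A $$ (i, j) \<ge> 0"
    and zero_diag: "i < n \<Longrightarrow> A $$ (i, i) = 0"
    and balanceable: "balanceable A"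
begin

definition scaled_entries :: "real vec \<Rightarrow> nat \<Rightarrow> nat \<Rightarrow> real" where
  "scaled_entries u = rescaled (\<lambda>i j. A $$ (i, j)) (\<lambda>i. u $ i)"

definition scaled_total :: "real vec \<Rightarrow> real" where
  "scaled_total u = entry_total n (scaled_entries u)"

definition min_entry :: real where
  "min_entry = Min ((\<lambda>ij. A $$ ij) ` support A)"

definition diam :: nat where
  "diam = diameter (graph_of A)"

lemma support_iff: "(i, j) \<in> support A \<longleftrightarrow> i < n \<and> j < n \<and> A $$ (i, j) \<noteq> 0"
  using carrier by (auto simp: support_def)

lemma finite_support: "finite (support A)"
  by (rule finite_subset[of _ "{..<n} \<times> {..<n}"]) (auto simp: support_iff)

lemma scaled_entries_nonneg: "i < n \<Longrightarrow> j < n \<Longrightarrow> scaled_entries u i j \<ge> 0"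
  using nonneg by (simp add: scaled_entries_def rescaled_def)

lemma scaled_index:
  assumes "u \<in> carrier_vec n" "i < n" "j < n"
  shows "scaled A u $$ (i, j) = scaled_entries u i j"
proof -
  have "dim_vec u = n" using assms by simp
  then have "scaled A u = Matrix.mat n n (\<lambda>(i, j). exp (u $ i) * A $$ (i, j)) * mat_diag n (\<lambda>i. exp ((- u) $ i))"
    using carrier by (simp add: scaled_def diag_exp_def mat_diag_mult_left)
  also have "\<dots> = Matrix.mat n n (\<lambda>(i, j). exp (u $ i) * A $$ (i, j) * exp ((- u) $ j))"
    by (subst mat_diag_mult_right) (auto intro!: cong_mat)
  finally show ?thesis
    using assms by (simp add: scaled_entries_def rescaled_def exp_diff exp_minus field_simps)
qed

lemma scaled_dim:
  assumes "u \<in> carrier_vec n"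
  shows "dim_row (scaled A u) = n" "dim_col (scaled A u) = n"
  using assms by (simp_all add: scaled_def diag_exp_def mat_diag_def)

lemma row_sum_scaled:
  "u \<in> carrier_vec n \<Longrightarrow> j < n \<Longrightarrow> row_sum (scaled A u) j = (\<Sum>k<n. scaled_entries u j k)"
  by (simp add: row_sum_def scaled_dim scaled_index)

lemma col_sum_scaled:
  "u \<in> carrier_vec n \<Longrightarrow> j < n \<Longrightarrow> col_sum (scaled A u) j = (\<Sum>k<n. scaled_entries u k j)"
  by (simp add: col_sum_def scaled_dim scaled_index)

lemma entry_sum_scaled: "u \<in> carrier_vec n \<Longrightarrow> entry_sum (scaled A u) = scaled_total u"
  by (simp add: entry_sum_def scaled_dim scaled_index scaled_total_def entry_total_def)

lemma eps_balances_iff: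
  "u \<in> carrier_vec n \<Longrightarrow> eps_balances \<epsilon> A u \<longleftrightarrow> imbalance n (scaled_entries u) \<le> \<epsilon> * scaled_total u"
  using carrier
  by (simp add: eps_balances_def entry_sum_scaled imbalance_def row_sum_scaled col_sum_scaled)

lemma scaled_total_zero: "scaled_total (0\<^sub>v n) = entry_sum A"
  using carrier by (simp add: scaled_total_def entry_total_def entry_sum_def scaled_entries_def rescaled_def)

lemma verts_graph: "verts (graph_of A) = {..<n}"
  and arcs_graph: "arcs (graph_of A) = support A"
  and tail_graph: "tail (graph_of A) = fst"
  and head_graph: "head (graph_of A) = snd"
  using carrier by (auto simp: graph_of_def)

sublocale G: wf_digraph "graph_of A"
  by unfold_locales (auto simp: verts_graph arcs_graph tail_graph head_graph support_iff)

text \<open>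
  Strong connectivity enters in two ways: it gives every vertex an edge out and an edge in, so that
  no row or column sum vanishes, and it bounds the spread of a scaling vector by the diameter.
\<close>
lemma connecting_walk:
  assumes "i < n" "j < n"
  obtains p where "G.awalk i p j"
proof -
  have "i \<rightarrow>\<^sup>*\<^bsub>graph_of A\<^esub> j"
    using balanceable assms
    unfolding balanceable_def strongly_connected_def verts_graph by blast
  then show ?thesis using that unfolding G.reachable_awalk by blast
qed

lemma exists_other: "i < n \<Longrightarrow> \<exists>j<n. j \<noteq> i"
  using n_ge_2 by (intro exI[of _ "if i = 0 then 1 else 0"]) auto

lemma row_support:
  assumes i: "i < n"
  shows "\<exists>j. (i, j) \<in> support A"
proof -
  obtain j where "j < n" "j \<noteq> i" using exists_other[OF i] by blast
  then obtain p where "G.awalk i p j" using connecting_walk i by blast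
  with \<open>j \<noteq> i\<close> show ?thesis
    by (cases p) (auto simp: G.awalk_Nil_iff G.awalk_Cons_iff arcs_graph tail_graph)
qed

lemma col_support:
  assumes j: "j < n"
  shows "\<exists>i. (i, j) \<in> support A"
proof -
  have walk: "\<exists>i. (i, j) \<in> support A" if "G.awalk i p j" "i \<noteq> j" for i p
    using that
  proof (induction p arbitrary: i)
    case Nil
    then show ?case by (simp add: G.awalk_Nil_iff)
  next
    case (Cons e p)
    then show ?case
      by (cases e; cases "snd e = j")
        (auto simp: G.awalk_Cons_iff arcs_graph tail_graph head_graph)
  qed
  obtain i where "i < n" "i \<noteq> j" using exists_other[OF j] by blast
  then show ?thesis using connecting_walk[of i j] walk j by blast
qed

lemma finite_distances:
  "finite ((\<lambda>(u, v). distance (graph_of A) u v) ` (verts (graph_of A) \<times> verts (graph_of A)))"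
  by (simp add: verts_graph)

lemma short_walk:
  assumes "i < n" "j < n"
  obtains p where "G.awalk i p j" "length p \<le> diam"
proof -
  obtain q where "G.awalk i q j" using connecting_walk assms by blast
  then have "\<exists>l. \<exists>p. G.awalk i p j \<and> length p = l" by blast
  then have "\<exists>p. G.awalk i p j \<and> length p = distance (graph_of A) i j"
    unfolding distance_def by (rule LeastI_ex)
  moreover have "distance (graph_of A) i j \<le> diam"
    unfolding diam_def diameter_def
    using assms by (intro Max_ge finite_distances) (force simp: verts_graph)
  ultimately show ?thesis using that by auto
qed

lemma diam_pos: "diam \<ge> 1"
proof -
  obtain p where "G.awalk 0 p 1" "length p \<le> diam" using short_walk[of 0 1] n_ge_2 by auto
  then show ?thesis by (cases p) (auto simp: G.awalk_Nil_iff)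
qed

lemma support_nonempty: "support A \<noteq> {}"
  using row_support[of 0] n_ge_2 by auto

lemma min_entry_le: "(i, j) \<in> support A \<Longrightarrow> min_entry \<le> A $$ (i, j)"
  unfolding min_entry_def by (intro Min_le) (auto simp: finite_support)

lemma min_entry_pos: "min_entry > 0"
proof -
  have "min_entry \<in> (\<lambda>ij. A $$ ij) ` support A"
    unfolding min_entry_def using finite_support support_nonempty by (intro Min_in) auto
  then obtain i j where "min_entry = A $$ (i, j)" "(i, j) \<in> support A" by auto
  then show ?thesis using nonneg[of i j] by (auto simp: support_iff)
qed

lemma kappa_eq: "kappa A = scaled_total (0\<^sub>v n) / min_entry"
  by (simp add: kappa_def scaled_total_zero min_entry_def)

text \<open>
  At an index \<open>i\<close> where \<open>u\<close> is maximal, scaling does not decrease any entry of row \<open>i\<close>, and this row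
  has a nonzero entry.
\<close>
lemma min_entry_le_scaled_total: "min_entry \<le> scaled_total u"
proof -
  obtain i where i: "i < n" "\<And>k. k < n \<Longrightarrow> u $ k \<le> u $ i"
  proof -
    have "Max ((\<lambda>k. u $ k) ` {..<n}) \<in> (\<lambda>k. u $ k) ` {..<n}"
      using n_ge_2 by (intro Max_in) (auto simp: lessThan_empty_iff)
    then obtain i where "i < n" "Max ((\<lambda>k. u $ k) ` {..<n}) = u $ i" by auto
    then show ?thesis using that[of i] by (metis Max_ge finite_imageI finite_lessThan imageI lessThan_iff)
  qed
  obtain j where j: "(i, j) \<in> support A" using row_support i by blast
  then have "j < n" by (simp add: support_iff)
  have "min_entry \<le> A $$ (i, j)" using j by (rule min_entry_le)
  also have "\<dots> \<le> scaled_entries u i j"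
    using i \<open>j < n\<close> nonneg[of i j] by (auto simp: scaled_entries_def rescaled_def mult_le_cancel_right1)
  also have "\<dots> \<le> scaled_total u"
    unfolding scaled_total_def scaled_entries_def using i \<open>j < n\<close> nonneg by (intro rescaled_le_total) auto
  finally show ?thesis .
qed

lemma scaled_total_pos: "scaled_total u > 0"
  using min_entry_pos min_entry_le_scaled_total[of u] by linarith

lemma kappa_ge_2: "kappa A \<ge> 2"
proof -
  have row: "min_entry \<le> (\<Sum>j<n. A $$ (i, j))" if i: "i < n" for i
  proof -
    obtain j where j: "(i, j) \<in> support A" using row_support[OF i] by blast
    then have "A $$ (i, j) \<le> (\<Sum>j<n. A $$ (i, j))"
      using i nonneg by (intro member_le_sum) (auto simp: support_iff)
    then show ?thesis using min_entry_le[OF j] by linarith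
  qed
  have "2 * min_entry \<le> n * min_entry"
    using n_ge_2 min_entry_pos by (intro mult_right_mono) auto
  also have "\<dots> = (\<Sum>i<n. min_entry)" by simp
  also have "\<dots> \<le> (\<Sum>i<n. \<Sum>j<n. A $$ (i, j))" using row by (intro sum_mono) auto
  also have "\<dots> = scaled_total (0\<^sub>v n)" using carrier by (simp add: scaled_total_zero entry_sum_def)
  finally show ?thesis using min_entry_pos by (simp add: kappa_eq field_simps)
qed

lemma ln_kappa_ge: "ln (kappa A) \<ge> 1 / 2"
proof -
  have "1 - 1 / (2::real) \<le> ln 2" using ln_one_minus_pos_upper_bound[of "1/2"] by (simp add: ln_div)
  also have "ln 2 \<le> ln (kappa A)" using kappa_ge_2 by (subst ln_le_cancel_iff) auto
  finally show ?thesis by simp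
qed

text \<open>
  A single scaled entry cannot exceed the total, so \<open>u i - u j \<le> ln (F(0) / A(i, j))\<close>.
\<close>
lemma edge_spread:
  assumes le: "scaled_total u \<le> scaled_total (0\<^sub>v n)" and e: "(i, j) \<in> support A"
  shows "u $ i - u $ j \<le> ln (kappa A)"
proof -
  have ij: "i < n" "j < n" using e by (auto simp: support_iff)
  have "exp (u $ i - u $ j) * min_entry \<le> scaled_entries u i j"
    using min_entry_le[OF e] by (simp add: scaled_entries_def rescaled_def)
  also have "\<dots> \<le> scaled_total (0\<^sub>v n)"
    using rescaled_le_total[of n "\<lambda>i j. A $$ (i, j)" i j "\<lambda>i. u $ i"] le nonneg ij
    by (simp add: scaled_total_def scaled_entries_def)
  finally have "exp (u $ i - u $ j) \<le> kappa A"
    using min_entry_pos by (simp add: kappa_eq field_simps)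
  then show ?thesis using kappa_ge_2 by (subst ln_ge_iff) auto
qed

lemma walk_spread:
  assumes "scaled_total u \<le> scaled_total (0\<^sub>v n)" "G.awalk i p j"
  shows "u $ i - u $ j \<le> length p * ln (kappa A)"
  using assms(2)
proof (induction p arbitrary: i)
  case Nil
  then show ?case by (simp add: G.awalk_Nil_iff)
next
  case (Cons e p)
  then have "u $ i - u $ (snd e) \<le> ln (kappa A)" "u $ (snd e) - u $ j \<le> length p * ln (kappa A)"
    using edge_spread[OF assms(1), of "fst e" "snd e"]
    by (auto simp: G.awalk_Cons_iff arcs_graph head_graph tail_graph)
  then show ?case by (simp add: algebra_simps)
qed

lemma spread:
  assumes "scaled_total u \<le> scaled_total (0\<^sub>v n)" "i < n" "j < n"
  shows "\<bar>u $ i - u $ j\<bar> \<le> diam * ln (kappa A)"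
proof -
  have "u $ i - u $ j \<le> diam * ln (kappa A)" if "i < n" "j < n" for i j
  proof -
    obtain p where "G.awalk i p j" "length p \<le> diam" using short_walk[OF \<open>i < n\<close> \<open>j < n\<close>] .
    then have "u $ i - u $ j \<le> length p * ln (kappa A)" using walk_spread assms(1) by blast
    also have "\<dots> \<le> diam * ln (kappa A)"
      using \<open>length p \<le> diam\<close> ln_kappa_ge by (intro mult_right_mono) auto
    finally show ?thesis .
  qed
  from this[of i j] this[of j i] show ?thesis using assms by linarith
qed

lemma osborne_partial_dim: "dim_vec (osborne_partial A u j) = dim_vec u"
  by (induction j) (simp_all add: Let_def)

lemma osborne_partial_carrier: "u \<in> carrier_vec n \<Longrightarrow> osborne_partial A u j \<in> carrier_vec n"
  by (metis carrier_vec_dim_vec carrier_vecD osborne_partial_dim)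

lemma osborne_partial_untouched:
  assumes "i < dim_vec u" "j \<le> i"
  shows "osborne_partial A u j $ i = u $ i"
  using assms by (induction j) (simp_all add: Let_def osborne_partial_dim)

lemma osborne_partial_settled:
  assumes "i < dim_vec u" "i < j" "j \<le> k"
  shows "osborne_partial A u k $ i = osborne_partial A u j $ i"
  using assms(3) by (induction k rule: dec_induct) (use assms in \<open>simp_all add: Let_def osborne_partial_dim\<close>)

lemma scaled_entries_row_pos:
  assumes "j < n"
  shows "(\<Sum>k<n. scaled_entries u j k) > 0"
proof -
  obtain k where "(j, k) \<in> support A" using row_support assms by blast
  then show ?thesis
    using assms nonneg[of j k]
    by (intro sum_pos2[of _ k]) (auto simp: support_iff scaled_entries_nonneg,
        simp add: scaled_entries_def rescaled_def)
qed

lemma scaled_entries_col_pos: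
  assumes "j < n"
  shows "(\<Sum>k<n. scaled_entries u k j) > 0"
proof -
  obtain k where "(k, j) \<in> support A" using col_support assms by blast
  then show ?thesis
    using assms nonneg[of k j]
    by (intro sum_pos2[of _ k]) (auto simp: support_iff scaled_entries_nonneg,
        simp add: scaled_entries_def rescaled_def)
qed

text \<open>
  The vector \<open>v\<close> at the update of \<open>j\<close> agrees with \<open>u'\<close> below \<open>j\<close> and with \<open>u\<close> from \<open>j\<close> on. Hence the
  hybrid sums of the sweep are the row and column sums of the matrix scaled by \<open>v\<close>, and the value
  assigned to coordinate \<open>j\<close> is the one that makes them equal.
\<close>
lemma sweep_cycle:
  assumes u: "u \<in> carrier_vec n" and u': "u' = osborne_partial A u n"
  shows "sweep n (scaled_entries u) (\<lambda>j. u' $ j - u $ j)"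
proof (rule sweep.intro)
  show "scaled_entries u i j \<ge> 0" if "i < n" "j < n" for i j
    using that by (rule scaled_entries_nonneg)
  show "scaled_entries u i i = 0" if "i < n" for i
    using that by (simp add: scaled_entries_def rescaled_def zero_diag)
next
  fix j assume j: "j < n"
  define v where "v = osborne_partial A u j"
  have v: "v \<in> carrier_vec n"
    using osborne_partial_carrier[OF u] by (simp add: v_def)
  have v_index: "v $ k = (if k < j then u' $ k else u $ k)" if "k < n" for k
  proof -
    have "k < dim_vec u" using u that by simp
    then show ?thesis
      using osborne_partial_settled[of k u j n] osborne_partial_untouched[of k u j] j
      by (simp add: v_def u')
  qed
  have scaled_entries_v: "scaled_entries v i k = exp (v $ i - v $ k) * A $$ (i, k)"
    and scaled_entries_u: "scaled_entries u i k = exp (u $ i - u $ k) * A $$ (i, k)" for i k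
    by (simp_all add: scaled_entries_def rescaled_def)
  let ?mid = "\<lambda>i k. exp (if i < k then u' $ i - u $ i else - (u' $ k - u $ k)) * scaled_entries u i k"
  let ?r = "\<Sum>k<n. scaled_entries v j k" and ?c = "\<Sum>k<n. scaled_entries v k j"
  have r: "?r > 0" and c: "?c > 0" using scaled_entries_row_pos scaled_entries_col_pos j by auto
  have row: "hybrid_row n (scaled_entries u) ?mid j = ?r"
    unfolding hybrid_row_def
    by (intro sum.cong refl)
       (auto simp: v_index j scaled_entries_v scaled_entries_u exp_diff exp_minus field_simps)
  have col: "hybrid_col n (scaled_entries u) ?mid j = ?c"
    unfolding hybrid_col_def
    by (intro sum.cong refl)
       (auto simp: v_index j scaled_entries_v scaled_entries_u exp_diff exp_minus field_simps)
  have "u' $ j = osborne_partial A u (Suc j) $ j"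
    unfolding u' using j u by (intro osborne_partial_settled) auto
  also have "\<dots> = u $ j + 1/2 * ln ?c - 1/2 * ln ?r"
    using j u v by (simp add: Let_def osborne_partial_dim row_sum_scaled col_sum_scaled flip: v_def)
  finally have "exp (u' $ j - u $ j) * exp (ln ?r) = exp (- (u' $ j - u $ j)) * exp (ln ?c)"
    by (simp add: field_simps flip: exp_add)
  then show "exp (u' $ j - u $ j) * hybrid_row n (scaled_entries u) ?mid j
     = exp (- (u' $ j - u $ j)) * hybrid_col n (scaled_entries u) ?mid j"
    unfolding row col using r c by simp
qed

lemma cycle_progress:
  assumes u: "u \<in> carrier_vec n" and u': "u' = osborne_partial A u n"
  shows "(imbalance n (scaled_entries u'))\<^sup>2 \<le> 8 * scaled_total u * (scaled_total u - scaled_total u')"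
    and "scaled_total u' \<le> scaled_total u"
proof -
  interpret S: sweep n "scaled_entries u" "\<lambda>j. u' $ j - u $ j"
    "\<lambda>i j. exp (if i < j then u' $ i - u $ i else - (u' $ j - u $ j)) * scaled_entries u i j"
    "\<lambda>i j. exp ((u' $ i - u $ i) - (u' $ j - u $ j)) * scaled_entries u i j"
    using sweep_cycle[OF assms] .
  have fin: "(\<lambda>i j. exp ((u' $ i - u $ i) - (u' $ j - u $ j)) * scaled_entries u i j) = scaled_entries u'"
    by (auto simp: scaled_entries_def rescaled_def fun_eq_iff simp flip: exp_add mult.assoc)
  show "(imbalance n (scaled_entries u'))\<^sup>2 \<le> 8 * scaled_total u * (scaled_total u - scaled_total u')"
    using S.imbalance_after_squared_le unfolding fin scaled_total_def .
  have "scaled_total u - scaled_total u' \<ge> 0"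
    using S.decrease unfolding fin scaled_total_def
    by (auto intro!: sum_nonneg mult_nonneg_nonneg S.row_before_nonneg)
  then show "scaled_total u' \<le> scaled_total u" by simp
qed

lemma osborne_carrier: "osborne A k \<in> carrier_vec n"
proof (induction k)
  case 0
  then show ?case using carrier by simp
next
  case (Suc k)
  then show ?case using carrier by (simp add: osborne_partial_carrier)
qed

lemma osborne_step: "osborne A (Suc k) = osborne_partial A (osborne A k) n"
  using carrier by simp

lemma scaled_total_osborne_le: "scaled_total (osborne A k) \<le> scaled_total (0\<^sub>v n)"
proof (induction k)
  case 0
  then show ?case using carrier by simp
next
  case (Suc k)
  then show ?case
    using cycle_progress(2)[OF osborne_carrier osborne_step, of k] by linarith
qed

text \<open>
  The vectors \<open>u\<^sub>0, \<dots>, u\<^sub>T\<close> stay in the sublevel set of \<open>u\<^sub>0 = 0\<close>. The two vectors compared by the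
  convexity bound both have spread at most \<open>d ln \<kappa>\<close>, hence the constant \<open>R = 2 d ln \<kappa>\<close>.
\<close>
lemma cycles_until_balanced:
  assumes eps: "\<epsilon> > 0" and bad: "\<And>k. k \<le> T \<Longrightarrow> \<not> eps_balances \<epsilon> A (osborne A k)"
  shows "\<epsilon> < 2" "real T \<le> 512 * (ln (kappa A) / \<epsilon> * min (1 / \<epsilon>) (real diam))"
proof -
  define L where "L k = ln (scaled_total (osborne A k))" for k
  define e where "e k = imbalance n (scaled_entries (osborne A k)) / scaled_total (osborne A k)" for k
  define K where "K = ln (kappa A)"
  have large: "e k > \<epsilon>" if "k \<le> T" for k
    using bad[OF that] osborne_carrier scaled_total_pos[of "osborne A k"]
    by (simp add: e_def eps_balances_iff field_simps)
  have imb: "imbalance n (scaled_entries u) \<le> 2 * scaled_total u" for u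
    unfolding scaled_total_def by (intro imbalance_le_twice_total scaled_entries_nonneg)
  have "e 0 \<le> 2" using imb scaled_total_pos[of "osborne A 0"] by (simp add: e_def field_simps)
  then show eps2: "\<epsilon> < 2" using large[of 0] by simp
  have K: "K \<ge> 1 / 2" unfolding K_def by (rule ln_kappa_ge)
  have step: "(e (Suc k))\<^sup>2 / 32 \<le> L k - L (Suc k)" for k
    unfolding e_def L_def
    using cycle_progress[OF osborne_carrier osborne_step, of k]
    by (intro ln_decrease_ge scaled_total_pos imb) (auto simp: imbalance_def sum_nonneg)
  have gap: "L 0 - L T \<le> K"
  proof -
    have "L T \<ge> ln min_entry"
      unfolding L_def using min_entry_le_scaled_total min_entry_pos scaled_total_pos by (subst ln_le_cancel_iff) auto
    moreover have "L 0 = K + ln min_entry"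
      using carrier scaled_total_pos[of "0\<^sub>v n"] min_entry_pos by (simp add: L_def K_def kappa_eq ln_div)
    ultimately show ?thesis by simp
  qed
  have convex: "L k - L T \<le> (2 * diam * K) * e k" for k
    unfolding L_def e_def scaled_total_def scaled_entries_def
  proof (rule ln_total_diff_le)
    fix i assume i: "i < n"
    have "0 < n" using n_ge_2 by simp
    show "\<bar>osborne A T $ i - osborne A k $ i - (osborne A T $ 0 - osborne A k $ 0)\<bar> \<le> 2 * diam * K"
      using spread[OF scaled_total_osborne_le i \<open>0 < n\<close>, of T] spread[OF scaled_total_osborne_le i \<open>0 < n\<close>, of k]
      unfolding K_def by linarith
  qed (use nonneg scaled_total_pos in \<open>auto simp: scaled_total_def scaled_entries_def\<close>)
  have R: "K \<le> 2 * diam * K"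
    using diam_pos K mult_right_mono[of 1 "2 * real diam" K] by simp
  have "real T \<le> 32 * K / \<epsilon>\<^sup>2" "real T \<le> 256 * (2 * diam * K) / \<epsilon>"
    using descent_steps_le[of \<epsilon> K "2 * diam * K" L T e] eps eps2 K R gap step large convex by auto
  moreover have "32 * K / \<epsilon>\<^sup>2 \<le> 512 * (K / \<epsilon> * (1 / \<epsilon>))"
    using eps K by (simp add: power2_eq_square field_simps)
  ultimately have "real T \<le> 512 * (K / \<epsilon> * (1 / \<epsilon>))" "real T \<le> 512 * (K / \<epsilon> * real diam)"
    by (auto simp: mult_ac)
  then show "real T \<le> 512 * (ln (kappa A) / \<epsilon> * min (1 / \<epsilon>) (real diam))"
    unfolding K_def by (auto simp: min_def)
qed

text \<open>
  A run that has failed up to time \<open>\<lfloor>520 b\<rfloor>\<close> would give \<open>520 b - 1 < 512 b\<close>. This is absurd because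
  \<open>b \<ge> 1 / 8\<close> in case of a failure: the zero vector already is a 2-balancing, so \<open>\<epsilon> < 2\<close>, while
  \<open>ln \<kappa> \<ge> 1 / 2\<close>.
\<close>
lemma exists_balanced_cycle:
  assumes eps: "\<epsilon> > 0"
  shows "\<exists>t. real t \<le> 520 * (ln (kappa A) / \<epsilon> * min (1 / \<epsilon>) (real diam))
    \<and> eps_balances \<epsilon> A (osborne A t)"
proof (rule ccontr)
  define b where "b = ln (kappa A) / \<epsilon> * min (1 / \<epsilon>) (real diam)"
  assume "\<not> ?thesis"
  then have none: "\<not> eps_balances \<epsilon> A (osborne A k)" if "real k \<le> 520 * b" for k
    using that by (auto simp: b_def)
  have b: "b \<ge> 0"
    using eps ln_kappa_ge by (simp add: b_def)
  define T where "T = nat \<lfloor>520 * b\<rfloor>"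
  have T: "real T \<le> 520 * b" "520 * b < real T + 1"
    using b by (auto simp: T_def)
  have bad: "\<not> eps_balances \<epsilon> A (osborne A k)" if "k \<le> T" for k
    using that T by (intro none) linarith
  have cycles: "\<epsilon> < 2" "real T \<le> 512 * b"
    using cycles_until_balanced[OF eps, of T] bad by (auto simp: b_def)
  have "1 / 2 \<le> min (1 / \<epsilon>) (real diam)"
    using cycles(1) eps diam_pos by (auto simp: field_simps)
  moreover have "1 / 4 \<le> ln (kappa A) / \<epsilon>"
    using cycles(1) eps ln_kappa_ge by (simp add: field_simps)
  ultimately have "1 / 4 * (1 / 2) \<le> b"
    unfolding b_def using eps ln_kappa_ge by (intro mult_mono) auto
  then show False using cycles(2) T by linarith
qed

end

section \<open>The straight-line program and its cost\<close>

lemma exec_append: "exec (P @ Q) s = exec Q (exec P s)"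
  and exec_Nil: "exec [] s = s"
  and exec_Cons: "exec (x # P) s = exec P (exec_instr x s)"
  by (simp_all add: exec_def)

definition accumulator :: "cell \<Rightarrow> bool" where
  "accumulator c \<longleftrightarrow> c = RowAcc \<or> c = ColAcc"

lemma exec_add_term:
  assumes "accumulator acc"
  shows "exec (add_term acc i j) s acc = s acc + exp (s (Coord i) - s (Coord j)) * s (Entry i j)"
    and "c \<noteq> Tmp \<Longrightarrow> c \<noteq> acc \<Longrightarrow> exec (add_term acc i j) s c = s c"
  using assms by (auto simp: accumulator_def add_term_def exec_Cons exec_Nil)

lemma exec_add_terms:
  assumes acc: "accumulator acc"
  shows "exec (concat (map (\<lambda>i. add_term acc (f i) (g i)) xs)) s acc
      = s acc + (\<Sum>i\<leftarrow>xs. exp (s (Coord (f i)) - s (Coord (g i))) * s (Entry (f i) (g i)))"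
    and "c \<noteq> Tmp \<Longrightarrow> c \<noteq> acc \<Longrightarrow>
      exec (concat (map (\<lambda>i. add_term acc (f i) (g i)) xs)) s c = s c"
proof (induction xs arbitrary: s)
  case (Cons x xs)
  have neq: "Coord i \<noteq> acc" "Entry i j \<noteq> acc" for i j
    using acc by (auto simp: accumulator_def)
  {
    case 1
    show ?case by (simp add: exec_append exec_add_term[OF acc] neq Cons(1))
  next
    case 2
    then show ?case by (simp add: exec_append exec_add_term[OF acc] Cons(2))
  }
qed (simp_all add: exec_Nil)

text \<open>
  The contents of the two accumulators before the coordinate \<open>j\<close> is changed, in terms of the memory
  \<open>s\<close> at the start of its update.
\<close>
definition col_value :: "nat \<Rightarrow> (nat \<times> nat) set \<Rightarrow> memory \<Rightarrow> nat \<Rightarrow> real" where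
  "col_value n E s j = (\<Sum>i\<leftarrow>filter (\<lambda>i. (i, j) \<in> E) [0..<n].
     exp (s (Coord i) - s (Coord j)) * s (Entry i j))"

definition row_value :: "nat \<Rightarrow> (nat \<times> nat) set \<Rightarrow> memory \<Rightarrow> nat \<Rightarrow> real" where
  "row_value n E s j = (\<Sum>i\<leftarrow>filter (\<lambda>i. (j, i) \<in> E) [0..<n].
     exp (s (Coord j) - s (Coord i)) * s (Entry j i))"

lemma exec_update_program:
  shows "exec (update_program n E j) s (Coord i) =
      (if i = j then s (Coord j) + 1/2 * ln (col_value n E s j) - 1/2 * ln (row_value n E s j)
       else s (Coord i))"
    and "exec (update_program n E j) s (Entry i k) = s (Entry i k)"
proof -
  define s1 where "s1 = exec [Add ColAcc (Lit 0) (Lit 0)] s"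
  define s2 where "s2 = exec (concat (map (\<lambda>i. add_term ColAcc i j) (filter (\<lambda>i. (i, j) \<in> E) [0..<n]))) s1"
  define s3 where "s3 = exec [Add RowAcc (Lit 0) (Lit 0)] s2"
  define s4 where "s4 = exec (concat (map (\<lambda>i. add_term RowAcc j i) (filter (\<lambda>i. (j, i) \<in> E) [0..<n]))) s3"
  note acc = accumulator_def[of ColAcc, simplified] accumulator_def[of RowAcc, simplified]
  have s1: "s1 ColAcc = 0" "s1 (Coord i) = s (Coord i)" "s1 (Entry i k) = s (Entry i k)" for i k
    by (simp_all add: s1_def exec_Cons exec_Nil)
  have s2: "s2 ColAcc = col_value n E s j" "s2 (Coord i) = s (Coord i)"
    "s2 (Entry i k) = s (Entry i k)" for i k
    by (simp_all add: s2_def exec_add_terms acc s1 col_value_def)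
  have s3: "s3 ColAcc = col_value n E s j" "s3 RowAcc = 0" "s3 (Coord i) = s (Coord i)"
    "s3 (Entry i k) = s (Entry i k)" for i k
    by (simp_all add: s3_def exec_Cons exec_Nil s2)
  have s4: "s4 ColAcc = col_value n E s j" "s4 RowAcc = row_value n E s j"
    "s4 (Coord i) = s (Coord i)" "s4 (Entry i k) = s (Entry i k)" for i k
    by (simp_all add: s4_def exec_add_terms acc s3 row_value_def)
  have "exec (update_program n E j) s = exec
      [Log Tmp (Cell ColAcc),
        Mul Tmp (Lit (1/2)) (Cell Tmp),
        Add (Coord j) (Cell (Coord j)) (Cell Tmp),
        Log Tmp (Cell RowAcc),
        Mul Tmp (Lit (1/2)) (Cell Tmp),
        Sub (Coord j) (Cell (Coord j)) (Cell Tmp)] s4"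
    unfolding update_program_def exec_append s1_def s2_def s3_def s4_def ..
  then show "exec (update_program n E j) s (Coord i) =
      (if i = j then s (Coord j) + 1/2 * ln (col_value n E s j) - 1/2 * ln (row_value n E s j)
       else s (Coord i))"
    "exec (update_program n E j) s (Entry i k) = s (Entry i k)"
    by (simp_all add: exec_Cons exec_Nil s4)
qed

lemma length_add_terms: "length (concat (map (\<lambda>i. add_term acc (f i) (g i)) xs)) = 4 * length xs"
  by (induction xs) (simp_all add: add_term_def)

lemma length_update_program:
  "length (update_program n E j) = 8 + 4 * card {i\<in>{..<n}. (i, j) \<in> E} + 4 * card {i\<in>{..<n}. (j, i) \<in> E}"
proof -
  have "length (filter P [0..<n]) = card {i\<in>{..<n}. P i}" for P
    using distinct_card[of "filter P [0..<n]"] by (simp add: lessThan_def set_eq_iff atLeast0LessThan)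
  then show ?thesis by (simp add: update_program_def length_add_terms)
qed

text \<open>
  Every entry is used in two updates, by four instructions each; the constant part of an update
  consists of two resets and of six instructions that change the coordinate.
\<close>
lemma length_cycle_program:
  assumes "E \<subseteq> {..<n} \<times> {..<n}"
  shows "length (cycle_program n E) = 8 * n + 8 * card E"
proof -
  have col: "(\<Sum>j<n. card {i\<in>{..<n}. (i, j) \<in> E}) = card E"
  proof -
    have "(\<Sum>j<n. card {i\<in>{..<n}. (i, j) \<in> E}) = card (SIGMA j:{..<n}. {i\<in>{..<n}. (i, j) \<in> E})"
      by (simp add: card_SigmaI)
    also have "(SIGMA j:{..<n}. {i\<in>{..<n}. (i, j) \<in> E}) = prod.swap ` E"
      using assms by force
    finally show ?thesis by (simp add: card_image)
  qed
  have row: "(\<Sum>j<n. card {i\<in>{..<n}. (j, i) \<in> E}) = card E"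
  proof -
    have "(\<Sum>j<n. card {i\<in>{..<n}. (j, i) \<in> E}) = card (SIGMA j:{..<n}. {i\<in>{..<n}. (j, i) \<in> E})"
      by (simp add: card_SigmaI)
    also have "(SIGMA j:{..<n}. {i\<in>{..<n}. (j, i) \<in> E}) = E"
      using assms by force
    finally show ?thesis .
  qed
  have "length (cycle_program n E) = (\<Sum>j<n. length (update_program n E j))"
    by (simp add: cycle_program_def length_concat comp_def interv_sum_list_conv_sum_set_nat
        atLeast0LessThan)
  also have "\<dots> = 8 * n + 4 * card E + 4 * card E"
    unfolding length_update_program sum.distrib sum_distrib_left[symmetric] col row by simp
  finally show ?thesis by simp
qed

context balanceable_matrix
begin

text \<open>
  The invariant of the program. Nothing is said about the accumulators and the temporary cell, as every
  update resets them.
\<close>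
definition holds :: "memory \<Rightarrow> real vec \<Rightarrow> bool" where
  "holds s v \<longleftrightarrow> (\<forall>i<n. s (Coord i) = v $ i) \<and> (\<forall>(i, j)\<in>support A. s (Entry i j) = A $$ (i, j))"

lemma holds_sums:
  assumes "holds s v" "v \<in> carrier_vec n" "j < n"
  shows "col_value n (support A) s j = col_sum (scaled A v) j"
    and "row_value n (support A) s j = row_sum (scaled A v) j"
proof -
  have supp: "(i, k) \<in> support A \<Longrightarrow>
      exp (s (Coord i) - s (Coord k)) * s (Entry i k) = scaled_entries v i k"
    and zero: "(i, k) \<notin> support A \<Longrightarrow> i < n \<Longrightarrow> k < n \<Longrightarrow> scaled_entries v i k = 0" for i k
    using assms(1) by (auto simp: holds_def scaled_entries_def rescaled_def support_iff)
  have "col_value n (support A) s j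
    = (\<Sum>i<n. if (i, j) \<in> support A then exp (s (Coord i) - s (Coord j)) * s (Entry i j) else 0)"
    by (simp add: col_value_def sum_list_map_filter' interv_sum_list_conv_sum_set_nat atLeast0LessThan)
  also have "\<dots> = (\<Sum>i<n. scaled_entries v i j)"
    using assms(3) by (intro sum.cong refl) (auto simp: supp zero)
  finally show "col_value n (support A) s j = col_sum (scaled A v) j"
    using assms by (simp add: col_sum_scaled)
  have "row_value n (support A) s j
    = (\<Sum>i<n. if (j, i) \<in> support A then exp (s (Coord j) - s (Coord i)) * s (Entry j i) else 0)"
    by (simp add: row_value_def sum_list_map_filter' interv_sum_list_conv_sum_set_nat atLeast0LessThan)
  also have "\<dots> = (\<Sum>i<n. scaled_entries v j i)"
    using assms(3) by (intro sum.cong refl) (auto simp: supp zero)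
  finally show "row_value n (support A) s j = row_sum (scaled A v) j"
    using assms by (simp add: row_sum_scaled)
qed

lemma holds_partial:
  assumes s: "holds s u" and u: "u \<in> carrier_vec n" and "m \<le> n"
  shows "holds (exec (concat (map (update_program n (support A)) [0..<m])) s) (osborne_partial A u m)"
  using \<open>m \<le> n\<close>
proof (induction m)
  case 0
  then show ?case using s by (simp add: exec_Nil)
next
  case (Suc m)
  define v where "v = osborne_partial A u m"
  define s' where "s' = exec (concat (map (update_program n (support A)) [0..<m])) s"
  have h: "holds s' v" using Suc by (simp add: s'_def v_def)
  have v: "v \<in> carrier_vec n" using osborne_partial_carrier[OF u] by (simp add: v_def)
  have um: "s' (Coord m) = u $ m"
    using h Suc.prems u by (simp add: holds_def v_def osborne_partial_untouched)
  have "holds (exec (update_program n (support A) m) s') (osborne_partial A u (Suc m))"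
    unfolding holds_def
  proof (intro conjI allI impI ballI)
    fix i assume i: "i < n"
    have dim: "dim_vec v = n" using v by simp
    show "exec (update_program n (support A) m) s' (Coord i) = osborne_partial A u (Suc m) $ i"
      using h i Suc.prems dim um
      by (simp add: exec_update_program Let_def holds_sums[OF h v] flip: v_def)
        (simp add: holds_def)
  next
    fix ij assume "ij \<in> support A"
    then show "case ij of (i, j) \<Rightarrow> exec (update_program n (support A) m) s' (Entry i j) = A $$ (i, j)"
      using h by (auto simp: holds_def exec_update_program)
  qed
  then show ?case by (simp add: exec_append s'_def)
qed

lemma holds_program:
  "holds (exec (osborne_program n (support A) t) (initial_memory A)) (osborne A t)"
proof (induction t)
  case 0
  then show ?case
    using carrier by (auto simp: holds_def osborne_program_def exec_Nil initial_memory_def)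
next
  case (Suc t)
  have "osborne_program n (support A) (Suc t) = osborne_program n (support A) t @ cycle_program n (support A)"
    unfolding osborne_program_def
    by (subst replicate_Suc, subst replicate_append_same[symmetric]) simp
  then show ?case
    using holds_partial[OF Suc osborne_carrier, of n] osborne_step
    by (simp add: exec_append cycle_program_def del: osborne.simps)
qed

lemma dim_le_num_nonzeros: "n \<le> num_nonzeros A"
proof -
  have "{..<n} \<subseteq> fst ` support A" using row_support by force
  then have "card {..<n} \<le> card (fst ` support A)" by (intro card_mono) (auto simp: finite_support)
  also have "\<dots> \<le> card (support A)" by (rule card_image_le[OF finite_support])
  finally show ?thesis by (simp add: num_nonzeros_def)
qed

lemma num_ops_le: "num_ops (osborne_program n (support A) t) \<le> 16 * num_nonzeros A * t"
proof -
  have "length (cycle_program n (support A)) \<le> 16 * num_nonzeros A"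
  proof -
    have "support A \<subseteq> {..<n} \<times> {..<n}" by (auto simp: support_iff)
    then show ?thesis
      using length_cycle_program[of "support A" n] dim_le_num_nonzeros
      by (simp add: num_nonzeros_def)
  qed
  then show ?thesis
    by (simp add: num_ops_def osborne_program_def length_concat sum_list_replicate mult.commute)
qed

end

theorem theorem1:
  shows "\<exists>C::real. C > 0 \<and>
    (\<forall>(n::nat) (A::real mat) (\<epsilon>::real).
      n \<ge> 2 \<longrightarrow>
      A \<in> carrier_mat n n \<longrightarrow>
      (\<forall>i<n. \<forall>j<n. A $$ (i, j) \<ge> 0) \<longrightarrow>
      (\<forall>i<n. A $$ (i, i) = 0) \<longrightarrow>
      balanceable A \<longrightarrow>
      \<epsilon> > 0 \<longrightarrow>
      (let bound = ln (kappa A) / \<epsilon> * min (1 / \<epsilon>) (real (diameter (graph_of A)));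
           program = osborne_program n (support A)
       in \<exists>t::nat.
            real t \<le> C * bound \<and>
            eps_balances \<epsilon> A (osborne A t) \<and>
            (\<forall>i<n. exec (program t) (initial_memory A) (Coord i) = osborne A t $ i) \<and>
            real (num_ops (program t)) \<le> C * (real (num_nonzeros A) * bound)))"
proof (intro exI[of _ "16 * 520"] conjI allI impI)
  fix n :: nat and A :: "real mat" and \<epsilon> :: real
  assume "n \<ge> 2" "A \<in> carrier_mat n n" "\<forall>i<n. \<forall>j<n. A $$ (i, j) \<ge> 0"
    "\<forall>i<n. A $$ (i, i) = 0" "balanceable A"
  then interpret balanceable_matrix n A by unfold_locales auto
  assume eps: "\<epsilon> > 0"
  define b where "b = ln (kappa A) / \<epsilon> * min (1 / \<epsilon>) (real (diameter (graph_of A)))"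
  obtain t where t: "real t \<le> 520 * b" "eps_balances \<epsilon> A (osborne A t)"
    using exists_balanced_cycle[OF eps] by (auto simp: b_def diam_def)
  have "b \<ge> 0" using t(1) by linarith
  have "real (num_ops (osborne_program n (support A) t)) \<le> real (16 * num_nonzeros A * t)"
    using num_ops_le by (simp only: of_nat_le_iff)
  also have "\<dots> \<le> 16 * real (num_nonzeros A) * (520 * b)"
    using mult_left_mono[OF t(1), of "16 * real (num_nonzeros A)"] by simp
  finally have ops: "real (num_ops (osborne_program n (support A) t)) \<le> 16 * 520 * (real (num_nonzeros A) * b)"
    by (simp add: mult_ac)
  have steps: "real t \<le> 16 * 520 * b" using t(1) \<open>b \<ge> 0\<close> by linarith
  show "let bound = ln (kappa A) / \<epsilon> * min (1 / \<epsilon>) (real (diameter (graph_of A)));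
           program = osborne_program n (support A)
       in \<exists>t::nat.
            real t \<le> 16 * 520 * bound \<and>
            eps_balances \<epsilon> A (osborne A t) \<and>
            (\<forall>i<n. exec (program t) (initial_memory A) (Coord i) = osborne A t $ i) \<and>
            real (num_ops (program t)) \<le> 16 * 520 * (real (num_nonzeros A) * bound)"
    unfolding Let_def b_def[symmetric]
    using steps t(2) ops holds_program[of t] by (intro exI[of _ t]) (simp add: holds_def)
qed simp

end
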